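(* For every $n\geq1$, $\pi_1(N_n)\simeq\langle a_1,\ldots,a_n\mid a_1^2\cdots a_n^2=1\rangle$.
   Context: Computational paths setting: paths are explicit rewrite sequences; $\sim$ is rewrite equality (equivalence closure of the $\mathrm{LND}_{\mathrm{EQ}}$-TRS, containing the groupoid laws); $\pi_1(A,a)=\mathrm{Path}(a,a)/{\sim}$. The non-orientable surface $N_n$ with $n$ crosscaps is the higher-inductive type with a point $\mathrm{base}$, loops $a_1,\ldots,a_n:\mathrm{Path}(\mathrm{base},\mathrm{base})$, and a 2-cell witnessing $a_1^2\cdots a_n^2$ is trivial (i.e. $\bigvee_n S^1$ with a disk attached along $a_1^2\cdots a_n^2$); $\pi_1$ is at $\mathrm{base}$. *)

theory Defs
  imports "HOL-Algebra.Generated_Groups"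
begin

section \<open>Computational paths\<close>

text \<open>
  Paths are terms recording explicitly how a rewrite sequence between two points is built from
  reflexivity \<open>\<rho>\<close>, basic rewrites, symmetry \<open>\<sigma>\<close> and transitivity \<open>\<tau>\<close>. In \<open>Trans p q\<close> the path
  \<open>p\<close> is traversed first.
\<close>

datatype ('p, 'e) cpath =
    Refl 'p
  | Gen 'e
  | Symm "('p, 'e) cpath"
  | Trans "('p, 'e) cpath" "('p, 'e) cpath"

text \<open>
  A higher inductive type given by its constructors. The point constructors are the elements of
  \<open>'p\<close>, the path constructors are \<open>gens\<close>, and \<open>(p, q) \<in> cells\<close> is a 2-cell from \<open>p\<close> to \<open>q\<close>.
\<close>

record ('p, 'e) hit =
  gens :: "'e set"
  src :: "'e \<Rightarrow> 'p"
  tgt :: "'e \<Rightarrow> 'p"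
  cells :: "(('p, 'e) cpath \<times> ('p, 'e) cpath) set"

inductive is_path :: "('p, 'e) hit \<Rightarrow> 'p \<Rightarrow> 'p \<Rightarrow> ('p, 'e) cpath \<Rightarrow> bool"
  for H :: "('p, 'e) hit" where
  Refl: "is_path H a a (Refl a)"
| Gen: "e \<in> gens H \<Longrightarrow> is_path H (src H e) (tgt H e) (Gen e)"
| Symm: "is_path H a b p \<Longrightarrow> is_path H b a (Symm p)"
| Trans: "is_path H a b p \<Longrightarrow> is_path H b c q \<Longrightarrow> is_path H a c (Trans p q)"

definition Path :: "('p, 'e) hit \<Rightarrow> 'p \<Rightarrow> 'p \<Rightarrow> ('p, 'e) cpath set" where
  "Path H a b = {p. is_path H a b p}"

text \<open>
  One-step rewriting between paths from \<open>a\<close> to \<open>b\<close>. The rules \<open>sr\<close> to \<open>tst\<close> are the rules of the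
  \<open>LND\<^sub>E\<^sub>Q\<close>-TRS for \<open>\<rho>\<close>, \<open>\<sigma>\<close>, \<open>\<tau>\<close>, under their usual names; a type given by the constructors above
  has no redexes for the remaining rules, which concern the term formers of products, sums,
  function types and substitution. The rule \<open>cell\<close> adds the 2-cells of the type, and the last three
  rules close under contexts.
\<close>

inductive rw :: "('p, 'e) hit \<Rightarrow> 'p \<Rightarrow> 'p \<Rightarrow> ('p, 'e) cpath \<Rightarrow> ('p, 'e) cpath \<Rightarrow> bool"
  for H :: "('p, 'e) hit" where
  sr: "rw H a a (Symm (Refl a)) (Refl a)"
| ss: "r \<in> Path H a b \<Longrightarrow> rw H a b (Symm (Symm r)) r"
| tr: "r \<in> Path H a b \<Longrightarrow> rw H a a (Trans r (Symm r)) (Refl a)"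
| tsr: "r \<in> Path H a b \<Longrightarrow> rw H b b (Trans (Symm r) r) (Refl b)"
| trr: "r \<in> Path H a b \<Longrightarrow> rw H a b (Trans r (Refl b)) r"
| tlr: "r \<in> Path H a b \<Longrightarrow> rw H a b (Trans (Refl a) r) r"
| stss: "r \<in> Path H a b \<Longrightarrow> s \<in> Path H b c \<Longrightarrow>
    rw H c a (Symm (Trans r s)) (Trans (Symm s) (Symm r))"
| tt: "t \<in> Path H a b \<Longrightarrow> r \<in> Path H b c \<Longrightarrow> s \<in> Path H c d \<Longrightarrow>
    rw H a d (Trans (Trans t r) s) (Trans t (Trans r s))"
| tts: "r \<in> Path H a b \<Longrightarrow> s \<in> Path H a c \<Longrightarrow> rw H a c (Trans r (Trans (Symm r) s)) s"
| tst: "r \<in> Path H a b \<Longrightarrow> s \<in> Path H b c \<Longrightarrow> rw H b c (Trans (Symm r) (Trans r s)) s"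
| cell: "(p, q) \<in> cells H \<Longrightarrow> p \<in> Path H a b \<Longrightarrow> q \<in> Path H a b \<Longrightarrow> rw H a b p q"
| cong_Symm: "rw H a b p q \<Longrightarrow> rw H b a (Symm p) (Symm q)"
| cong_Trans_left: "rw H a b p q \<Longrightarrow> r \<in> Path H b c \<Longrightarrow> rw H a c (Trans p r) (Trans q r)"
| cong_Trans_right: "r \<in> Path H a b \<Longrightarrow> rw H b c p q \<Longrightarrow> rw H a c (Trans r p) (Trans r q)"

definition rweq :: "('p, 'e) hit \<Rightarrow> 'p \<Rightarrow> 'p \<Rightarrow> (('p, 'e) cpath \<times> ('p, 'e) cpath) set" where
  "rweq H a b = {(p, q). p \<in> Path H a b \<and> q \<in> Path H a b \<and> equivclp (rw H a b) p q}"

definition fundamental_group :: "('p, 'e) hit \<Rightarrow> 'p \<Rightarrow> ('p, 'e) cpath set monoid" (\<open>\<pi>\<^sub>1\<close>) where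
  "\<pi>\<^sub>1 H a =
    \<lparr>carrier = Path H a a // rweq H a a,
     mult = (\<lambda>X Y. \<Union>p\<in>X. \<Union>q\<in>Y. rweq H a a `` {Trans p q}),
     one = rweq H a a `` {Refl a}\<rparr>"

lemma rw_Path: "rw H a b p q \<Longrightarrow> p \<in> Path H a b \<and> q \<in> Path H a b"
  by (induction rule: rw.induct) (auto simp: Path_def intro: is_path.intros)

lemma rweqI: "rw H a b p q \<Longrightarrow> (p, q) \<in> rweq H a b"
  using rw_Path by (fastforce simp: rweq_def intro: r_into_equivclp)

lemma equiv_rweq: "equiv (Path H a b) (rweq H a b)"
  by (rule equivI) (auto simp: rweq_def refl_on_def sym_def trans_def
      intro: equivclp_sym equivclp_trans)

lemma equivclp_map:
  assumes "equivclp r x y" and "\<And>x y. r x y \<Longrightarrow> s (f x) (f y)"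
  shows "equivclp s (f x) (f y)"
  using assms(1)
proof (induction rule: equivclp_induct)
  case base
  show ?case by simp
next
  case (step y z)
  then show ?case
    by (meson assms(2) equivclp_sym equivclp_trans r_into_equivclp)
qed

lemma rweq_Symm: "(p, q) \<in> rweq H a b \<Longrightarrow> (Symm p, Symm q) \<in> rweq H b a"
  by (auto simp: rweq_def Path_def intro: is_path.intros
      elim!: equivclp_map intro!: rw.cong_Symm)

lemma rweq_Trans:
  assumes "(p, p') \<in> rweq H a b" "(q, q') \<in> rweq H b c"
  shows "(Trans p q, Trans p' q') \<in> rweq H a c"
proof -
  have "equivclp (rw H a c) (Trans p q) (Trans p' q)"
    using assms
    by (intro equivclp_map[where f = "\<lambda>x. Trans x q" and r = "rw H a b"])
      (auto simp: rweq_def intro: rw.cong_Trans_left)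
  moreover have "equivclp (rw H a c) (Trans p' q) (Trans p' q')"
    using assms
    by (intro equivclp_map[where f = "Trans p'" and r = "rw H b c"])
      (auto simp: rweq_def intro: rw.cong_Trans_right)
  ultimately show ?thesis
    using assms by (auto simp: rweq_def Path_def intro: is_path.intros equivclp_trans)
qed

lemma mult_fundamental_group:
  assumes "p \<in> Path H a a" "q \<in> Path H a a"
  shows "(rweq H a a `` {p}) \<otimes>\<^bsub>\<pi>\<^sub>1 H a\<^esub> (rweq H a a `` {q}) = rweq H a a `` {Trans p q}"
proof -
  have "congruent2 (rweq H a a) (rweq H a a) (\<lambda>p q. rweq H a a `` {Trans p q})"
    by (rule congruent2I') (meson equiv_class_eq equiv_rweq rweq_Trans)
  then show ?thesis
    using UN_equiv_class2[OF equiv_rweq equiv_rweq] assms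
    by (simp add: fundamental_group_def)
qed

lemma group_fundamental_group: "group (\<pi>\<^sub>1 H a)"
proof -
  let ?c = "\<lambda>p. rweq H a a `` {p}"
  have carr: "carrier (\<pi>\<^sub>1 H a) = ?c ` Path H a a"
    by (auto simp: fundamental_group_def quotient_def)
  have one: "\<one>\<^bsub>\<pi>\<^sub>1 H a\<^esub> = ?c (Refl a)"
    by (simp add: fundamental_group_def)
  have Refl: "Refl a \<in> Path H a a"
    by (simp add: Path_def is_path.Refl)
  have Symm: "Symm p \<in> Path H a a" if "p \<in> Path H a a" for p
    using that by (simp add: Path_def is_path.Symm)
  have Trans: "Trans p q \<in> Path H a a" if "p \<in> Path H a a" "q \<in> Path H a a" for p q
    using that by (auto simp: Path_def intro: is_path.Trans)
  have eq: "?c p = ?c q" if "rw H a a p q" for p q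
    using that by (meson equiv_class_eq equiv_rweq rweqI)
  show ?thesis
  proof (rule groupI)
    fix x assume "x \<in> carrier (\<pi>\<^sub>1 H a)"
    then obtain p where p: "p \<in> Path H a a" "x = ?c p"
      by (auto simp: carr)
    have "?c (Symm p) \<otimes>\<^bsub>\<pi>\<^sub>1 H a\<^esub> x = \<one>\<^bsub>\<pi>\<^sub>1 H a\<^esub>"
      using p Symm by (simp add: mult_fundamental_group one eq rw.tsr)
    then show "\<exists>y\<in>carrier (\<pi>\<^sub>1 H a). y \<otimes>\<^bsub>\<pi>\<^sub>1 H a\<^esub> x = \<one>\<^bsub>\<pi>\<^sub>1 H a\<^esub>"
      using p Symm by (auto simp: carr)
  next
    show "x \<otimes>\<^bsub>\<pi>\<^sub>1 H a\<^esub> y \<otimes>\<^bsub>\<pi>\<^sub>1 H a\<^esub> z = x \<otimes>\<^bsub>\<pi>\<^sub>1 H a\<^esub> (y \<otimes>\<^bsub>\<pi>\<^sub>1 H a\<^esub> z)"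
      if "x \<in> carrier (\<pi>\<^sub>1 H a)" "y \<in> carrier (\<pi>\<^sub>1 H a)" "z \<in> carrier (\<pi>\<^sub>1 H a)" for x y z
      using that Trans eq[OF rw.tt] by (auto simp: carr mult_fundamental_group)
  qed (use Refl Trans eq[OF rw.tlr] in \<open>auto simp: carr one mult_fundamental_group\<close>)
qed

section \<open>Free groups and presentations\<close>

text \<open>The letter \<open>(x, True)\<close> stands for \<open>x\<close> and \<open>(x, False)\<close> for its formal inverse.\<close>

type_synonym 'e letter = "'e \<times> bool"

definition letter_inv :: "'e letter \<Rightarrow> 'e letter" where
  "letter_inv = map_prod id Not"

definition reduced :: "'e letter list \<Rightarrow> bool" where
  "reduced = successively (\<lambda>x y. y \<noteq> letter_inv x)"

fun cancel_cons :: "'e letter \<Rightarrow> 'e letter list \<Rightarrow> 'e letter list" where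
  "cancel_cons x [] = [x]"
| "cancel_cons x (y # w) = (if y = letter_inv x then w else x # y # w)"

definition reduce :: "'e letter list \<Rightarrow> 'e letter list" where
  "reduce w = foldr cancel_cons w []"

definition free_group :: "'e set \<Rightarrow> 'e letter list monoid" where
  "free_group X =
    \<lparr>carrier = {w \<in> lists (X \<times> UNIV). reduced w},
     mult = (\<lambda>u v. reduce (u @ v)),
     one = []\<rparr>"

definition normal_closure :: "('a, 'b) monoid_scheme \<Rightarrow> 'a set \<Rightarrow> 'a set" where
  "normal_closure G R =
    generate G {g \<otimes>\<^bsub>G\<^esub> r \<otimes>\<^bsub>G\<^esub> inv\<^bsub>G\<^esub> g | g r. g \<in> carrier G \<and> r \<in> R}"

text \<open>The group \<open>\<langle>X | r = 1 for r \<in> R\<rangle>\<close>, for reduced words \<open>R\<close> over \<open>X\<close>.\<close>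

definition presented_group :: "'e set \<Rightarrow> 'e letter list set \<Rightarrow> 'e letter list set monoid" where
  "presented_group X R = free_group X Mod normal_closure (free_group X) R"

lemma letter_inv_inv [simp]: "letter_inv (letter_inv x) = x"
  by (cases x) (simp add: letter_inv_def)

lemma letter_inv_in [simp]: "letter_inv x \<in> X \<times> UNIV \<longleftrightarrow> x \<in> X \<times> UNIV"
  by (cases x) (simp add: letter_inv_def)

lemma reduced_Nil [simp]: "reduced []"
  by (simp add: reduced_def)

lemma reduced_Cons: "reduced (x # w) \<longleftrightarrow> (w = [] \<or> hd w \<noteq> letter_inv x) \<and> reduced w"
  by (auto simp: reduced_def successively_Cons)

lemma reduced_cancel_cons: "reduced w \<Longrightarrow> reduced (cancel_cons x w)"
  by (cases w) (auto simp: reduced_Cons)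

lemma reduced_foldr: "reduced v \<Longrightarrow> reduced (foldr cancel_cons u v)"
  by (induction u) (auto intro: reduced_cancel_cons)

lemma reduce_reduced: "reduced w \<Longrightarrow> reduce w = w"
proof (induction w)
  case (Cons x w)
  then show ?case by (cases w) (auto simp: reduce_def reduced_Cons)
qed (simp add: reduce_def)

lemma cancel_cons_inv: "reduced w \<Longrightarrow> cancel_cons (letter_inv x) (cancel_cons x w) = w"
  by (cases w rule: remdups_adj.cases) (auto simp: reduced_Cons)

lemma cancel_cons_inv': "reduced w \<Longrightarrow> cancel_cons x (cancel_cons (letter_inv x) w) = w"
  using cancel_cons_inv[of w "letter_inv x"] by simp

lemma foldr_cancel_cons:
  "reduced w \<Longrightarrow> foldr cancel_cons (cancel_cons x v) w = cancel_cons x (foldr cancel_cons v w)"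
  by (cases v) (auto simp: cancel_cons_inv' reduced_foldr)

lemma foldr_foldr:
  "reduced w \<Longrightarrow>
    foldr cancel_cons (foldr cancel_cons u v) w = foldr cancel_cons u (foldr cancel_cons v w)"
  by (induction u) (auto simp: foldr_cancel_cons)

lemma cancel_cons_lists: "x \<in> A \<Longrightarrow> w \<in> lists A \<Longrightarrow> cancel_cons x w \<in> lists A"
  by (cases w) auto

lemma foldr_lists: "u \<in> lists A \<Longrightarrow> v \<in> lists A \<Longrightarrow> foldr cancel_cons u v \<in> lists A"
proof (induction u)
  case (Cons x u)
  then show ?case
    using cancel_cons_lists[of x A "foldr cancel_cons u v"] by simp
qed simp

lemma foldr_inv: "reduced v \<Longrightarrow> foldr cancel_cons (map letter_inv (rev u)) (foldr cancel_cons u v) = v"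
  by (induction u) (auto simp: cancel_cons_inv reduced_foldr)

lemma mult_free_group: "reduced v \<Longrightarrow> u \<otimes>\<^bsub>free_group X\<^esub> v = foldr cancel_cons u v"
  using reduce_reduced[of v] by (simp add: free_group_def reduce_def)

lemma group_free_group: "group (free_group X)"
proof -
  have carr: "w \<in> carrier (free_group X) \<longleftrightarrow> w \<in> lists (X \<times> UNIV) \<and> reduced w" for w
    by (simp add: free_group_def)
  have one: "\<one>\<^bsub>free_group X\<^esub> = []"
    by (simp add: free_group_def)
  show ?thesis
  proof (rule groupI)
    fix x assume "x \<in> carrier (free_group X)"
    then have x: "x \<in> lists (X \<times> UNIV)" "reduced x"
      by (simp_all add: carr)
    let ?y = "reduce (map letter_inv (rev x))"
    have "map letter_inv (rev x) \<in> lists (X \<times> UNIV)"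
      using x(1) by (auto simp: letter_inv_def subset_iff lists_eq_set)
    then have "?y \<in> lists (X \<times> UNIV)" "reduced ?y"
      unfolding reduce_def by (rule foldr_lists) (simp_all add: reduced_foldr)
    moreover have "?y \<otimes>\<^bsub>free_group X\<^esub> x = \<one>\<^bsub>free_group X\<^esub>"
      using x(2) foldr_inv[of "[]" x] reduce_reduced[OF x(2)]
      by (simp add: mult_free_group one reduce_def foldr_foldr)
    ultimately show "\<exists>y\<in>carrier (free_group X). y \<otimes>\<^bsub>free_group X\<^esub> x = \<one>\<^bsub>free_group X\<^esub>"
      using carr by blast
  next
    show "x \<otimes>\<^bsub>free_group X\<^esub> y \<in> carrier (free_group X)"
      if "x \<in> carrier (free_group X)" "y \<in> carrier (free_group X)" for x y
      using that foldr_lists[of x "X \<times> UNIV" y]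
      by (simp add: carr mult_free_group reduced_foldr del: in_lists_conv_set)
  qed (simp_all add: carr one mult_free_group foldr_foldr reduced_foldr)
qed

lemma (in group) normal_normal_closure:
  assumes "R \<subseteq> carrier G"
  shows "normal_closure G R \<lhd> G"
  unfolding normal_closure_def
proof (rule normal_generateI)
  show "{g \<otimes> r \<otimes> inv g |g r. g \<in> carrier G \<and> r \<in> R} \<subseteq> carrier G"
    using assms by auto
next
  fix h g
  assume "h \<in> {g \<otimes> r \<otimes> inv g |g r. g \<in> carrier G \<and> r \<in> R}" and g: "g \<in> carrier G"
  then obtain k r where k: "h = k \<otimes> r \<otimes> inv k" "k \<in> carrier G" "r \<in> R"
    by auto
  then have "g \<otimes> h \<otimes> inv g = (g \<otimes> k) \<otimes> r \<otimes> inv (g \<otimes> k)"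
    using assms g by (auto simp: m_assoc inv_mult_group subset_iff)
  then show "g \<otimes> h \<otimes> inv g \<in> {g \<otimes> r \<otimes> inv g |g r. g \<in> carrier G \<and> r \<in> R}"
    using k g by auto
qed

lemma group_presented_group:
  "R \<subseteq> carrier (free_group X) \<Longrightarrow> group (presented_group X R)"
  unfolding presented_group_def
  by (intro normal.factorgroup_is_group group.normal_normal_closure group_free_group)

section \<open>Non-orientable surfaces\<close>

datatype surface_point = base

definition squares_path :: "nat \<Rightarrow> (surface_point, nat) cpath" where
  "squares_path n = foldr (\<lambda>i p. Trans (Trans (Gen i) (Gen i)) p) [1..<Suc n] (Refl base)"

definition nonorientable_surface :: "nat \<Rightarrow> (surface_point, nat) hit" where
  "nonorientable_surface n =
    \<lparr>gens = {1..n}, src = (\<lambda>_. base), tgt = (\<lambda>_. base), cells = {(squares_path n, Refl base)}\<rparr>"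

definition squares_word :: "nat \<Rightarrow> nat letter list" where
  "squares_word n = concat (map (\<lambda>i. [(i, True), (i, True)]) [1..<Suc n])"

lemma squares_path_in_Path: "squares_path n \<in> Path (nonorientable_surface n) base base"
proof -
  have "set is \<subseteq> {1..n} \<Longrightarrow>
      foldr (\<lambda>i p. Trans (Trans (Gen i) (Gen i)) p) is (Refl base)
        \<in> Path (nonorientable_surface n) base base" for "is"
  proof (induction "is")
    case (Cons i "is")
    have "is_path (nonorientable_surface n) base base (Gen i)"
      using Cons.prems is_path.Gen[of i "nonorientable_surface n"]
      by (simp add: nonorientable_surface_def)
    then show ?case
      using Cons by (auto simp: Path_def intro: is_path.Trans)
  qed (simp add: Path_def is_path.Refl)
  then show ?thesis
    unfolding squares_path_def by (simp only: set_upt atLeastLessThanSuc_atLeastAtMost)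
qed

lemma squares_word_in_free_group: "squares_word n \<in> carrier (free_group {1..n})"
proof -
  have "(\<forall>l\<in>set w. snd l) \<Longrightarrow> reduced w" for w :: "nat letter list"
  proof (induction w)
    case (Cons x w)
    then show ?case
      using hd_in_set[of w] by (cases x; cases w) (auto simp: reduced_Cons letter_inv_def)
  qed simp
  then have "reduced (squares_word n)"
    by (auto simp: squares_word_def)
  then show ?thesis
    by (auto simp: free_group_def squares_word_def)
qed

end

theory Submission
  imports Defs
begin

text \<open>
  For a type with a single point \<open>b\<close>, path constructors \<open>X\<close> and 2-cells from loops \<open>r\<close> to
  \<open>Refl b\<close>, sending a generator to the class of its loop defines a surjective homomorphism \<open>\<phi>\<close>
  from the free group \<open>F\<close> on \<open>X\<close> to \<open>\<pi>\<^sub>1\<close>. Its kernel contains the normal closure \<open>N\<close> of the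
  relators because of the 2-cells. Conversely, evaluating paths in \<open>F Mod N\<close> is invariant under
  every rewrite rule, so a word whose loop is rewrite equal to \<open>Refl b\<close> lies in \<open>N\<close>. Hence
  \<open>F Mod N \<cong> \<pi>\<^sub>1\<close>.
\<close>

section \<open>Evaluation of paths in a group\<close>

fun path_eval :: "('g, 'm) monoid_scheme \<Rightarrow> ('e \<Rightarrow> 'g) \<Rightarrow> ('p, 'e) cpath \<Rightarrow> 'g" where
  "path_eval G f (Refl a) = \<one>\<^bsub>G\<^esub>"
| "path_eval G f (Gen e) = f e"
| "path_eval G f (Symm p) = inv\<^bsub>G\<^esub> (path_eval G f p)"
| "path_eval G f (Trans p q) = path_eval G f p \<otimes>\<^bsub>G\<^esub> path_eval G f q"

lemma (in group) path_eval_closed: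
  assumes "p \<in> Path H a b" and "f \<in> gens H \<rightarrow> carrier G"
  shows "path_eval G f p \<in> carrier G"
proof -
  have "is_path H a b p"
    using assms(1) by (simp add: Path_def)
  then show ?thesis
    using assms(2) by induction auto
qed

text \<open>Naturality of evaluation. It is applied to both homomorphisms out of the free group: the
  quotient map to \<open>F Mod N\<close> and \<phi>. Being a path keeps all intermediate values in
  the carrier, where \<open>h\<close> respects inverses and products.\<close>

lemma (in group_hom) hom_path_eval:
  assumes "p \<in> Path H' a b" and "f \<in> gens H' \<rightarrow> carrier G"
  shows "h (path_eval G f p) = path_eval H (h \<circ> f) p"
proof -
  have "is_path H' a b p"
    using assms(1) by (simp add: Path_def)
  then show ?thesis
  proof induction
    case (Symm a b p)
    then show ?case
      using G.path_eval_closed[OF _ assms(2)] by (simp add: Path_def)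
  next
    case (Trans a b p c q)
    then have "p \<in> Path H' a b" "q \<in> Path H' b c"
      by (simp_all add: Path_def)
    then show ?case
      using Trans.IH G.path_eval_closed[OF _ assms(2)] by simp
  qed simp_all
qed

text \<open>Each rule for \<open>Refl\<close>, \<open>Symm\<close> and \<open>Trans\<close> becomes
  an identity valid in every group, the context rules follow by induction, and only
  \<open>cell\<close> depends on the assumption about 2-cells.\<close>

lemma (in group) rw_path_eval:
  assumes "rw H a b p q" and f: "f \<in> gens H \<rightarrow> carrier G"
    and cells: "\<And>p q. (p, q) \<in> cells H \<Longrightarrow> path_eval G f p = path_eval G f q"
  shows "path_eval G f p = path_eval G f q"
proof -
  note closed = path_eval_closed[OF _ f]
  show ?thesis
    using assms(1)
  proof induction
    case (stss r a b s c)
    then show ?case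
      using closed by (simp add: inv_mult_group)
  next
    case (tt t a b r c s d)
    then show ?case
      using closed by (simp add: m_assoc)
  next
    case (tts r a b s c)
    then show ?case
      using closed by (simp add: m_assoc[symmetric])
  next
    case (tst r a b s c)
    then show ?case
      using closed by (simp add: m_assoc[symmetric])
  next
    case (cell p q a b)
    then show ?case
      using cells by blast
  qed (simp_all add: closed)
qed

lemma (in group) rweq_path_eval:
  assumes "(p, q) \<in> rweq H a b" and "f \<in> gens H \<rightarrow> carrier G"
    and "\<And>p q. (p, q) \<in> cells H \<Longrightarrow> path_eval G f p = path_eval G f q"
  shows "path_eval G f p = path_eval G f q"
proof -
  have "equivclp (rw H a b) p q"
    using assms(1) by (simp add: rweq_def)
  then show ?thesis
    by (induction rule: equivclp_induct) (use rw_path_eval[OF _ assms(2,3)] in metis)+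
qed

section \<open>Words and the universal property of free groups\<close>

lemma carrier_free_group: "carrier (free_group X) = {w \<in> lists (X \<times> UNIV). reduced w}"
  by (simp add: free_group_def)

lemma one_free_group: "\<one>\<^bsub>free_group X\<^esub> = []"
  by (simp add: free_group_def)

definition free_gen :: "'e \<Rightarrow> 'e letter list" where
  "free_gen x = [(x, True)]"

lemma free_gen_closed: "x \<in> X \<Longrightarrow> free_gen x \<in> carrier (free_group X)"
  by (simp add: free_gen_def carrier_free_group reduced_Cons)

lemma inv_free_gen:
  assumes "x \<in> X"
  shows "inv\<^bsub>free_group X\<^esub> (free_gen x) = [(x, False)]"
proof -
  interpret group "free_group X"
    by (rule group_free_group)
  show ?thesis
    using assms
    by (intro inv_equality)
      (auto simp: free_gen_def carrier_free_group one_free_group mult_free_group reduced_Cons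
        letter_inv_def)
qed

fun letter_eval :: "('g, 'm) monoid_scheme \<Rightarrow> ('e \<Rightarrow> 'g) \<Rightarrow> 'e letter \<Rightarrow> 'g" where
  "letter_eval G f (x, s) = (if s then f x else inv\<^bsub>G\<^esub> (f x))"

text \<open>For \<open>f\<close> with values in a group, this is the homomorphic extension of
  \<open>f\<close> to the free group.\<close>

definition word_eval :: "('g, 'm) monoid_scheme \<Rightarrow> ('e \<Rightarrow> 'g) \<Rightarrow> 'e letter list \<Rightarrow> 'g" where
  "word_eval G f w = foldr (\<lambda>l g. letter_eval G f l \<otimes>\<^bsub>G\<^esub> g) w \<one>\<^bsub>G\<^esub>"

lemma word_eval_simps [simp]:
  "word_eval G f [] = \<one>\<^bsub>G\<^esub>"
  "word_eval G f (l # w) = letter_eval G f l \<otimes>\<^bsub>G\<^esub> word_eval G f w"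
  by (simp_all add: word_eval_def)

context group
begin

lemma letter_eval_closed:
  "f \<in> X \<rightarrow> carrier G \<Longrightarrow> l \<in> X \<times> UNIV \<Longrightarrow> letter_eval G f l \<in> carrier G"
  by (cases l) auto

lemma letter_eval_inv:
  "f \<in> X \<rightarrow> carrier G \<Longrightarrow> l \<in> X \<times> UNIV \<Longrightarrow> letter_eval G f (letter_inv l) = inv (letter_eval G f l)"
  by (cases l) (auto simp: letter_inv_def Pi_iff)

lemma word_eval_closed:
  "f \<in> X \<rightarrow> carrier G \<Longrightarrow> w \<in> lists (X \<times> UNIV) \<Longrightarrow> word_eval G f w \<in> carrier G"
  by (induction w) (simp_all add: letter_eval_closed del: in_lists_conv_set)

text \<open>If \<open>cancel_cons\<close> deletes the head of \<open>w\<close>, that head is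
  \<open>letter_inv l\<close>, so its value cancels against that of \<open>l\<close>.\<close>

lemma word_eval_cancel_cons:
  assumes "f \<in> X \<rightarrow> carrier G" and "l \<in> X \<times> UNIV" and "w \<in> lists (X \<times> UNIV)"
  shows "word_eval G f (cancel_cons l w) = letter_eval G f l \<otimes> word_eval G f w"
proof (cases w)
  case (Cons k v)
  then have "v \<in> lists (X \<times> UNIV)"
    using assms(3) by simp
  then show ?thesis
    using Cons assms(1,2)
    by (simp add: letter_eval_inv letter_eval_closed word_eval_closed m_assoc[symmetric]
        del: in_lists_conv_set)
qed simp

text \<open>For reduced \<open>v\<close> the fold is the product in the free group, so this is
  multiplicativity of \<open>word_eval\<close>.\<close>

lemma word_eval_foldr_cancel_cons:
  assumes "f \<in> X \<rightarrow> carrier G" and "u \<in> lists (X \<times> UNIV)" and "v \<in> lists (X \<times> UNIV)"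
  shows "word_eval G f (foldr cancel_cons u v) = word_eval G f u \<otimes> word_eval G f v"
  using assms(2)
proof (induction u)
  case Nil
  then show ?case
    using word_eval_closed[OF assms(1,3)] by simp
next
  case (Cons l u)
  then have "foldr cancel_cons u v \<in> lists (X \<times> UNIV)"
    using assms(3) by (intro foldr_lists) simp_all
  then show ?case
    using Cons assms(1,3)
    by (simp add: word_eval_cancel_cons letter_eval_closed word_eval_closed m_assoc
        del: in_lists_conv_set)
qed

lemma group_hom_word_eval:
  assumes "f \<in> X \<rightarrow> carrier G"
  shows "group_hom (free_group X) G (word_eval G f)"
proof -
  have "word_eval G f \<in> hom (free_group X) G"
    using assms
    by (intro homI)
      (simp_all add: carrier_free_group word_eval_closed mult_free_group
        word_eval_foldr_cancel_cons del: in_lists_conv_set)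
  then show ?thesis
    by (simp add: group_hom_def group_hom_axioms_def group_free_group is_group)
qed

end

section \<open>Classes of loops in the fundamental group\<close>

lemma class_eq_iff_rweq:
  assumes "p \<in> Path H a a" and "q \<in> Path H a a"
  shows "rweq H a a `` {p} = rweq H a a `` {q} \<longleftrightarrow> (p, q) \<in> rweq H a a"
  using assms by (simp add: eq_equiv_class_iff[OF equiv_rweq])

lemma carrier_fundamental_group:
  "carrier (\<pi>\<^sub>1 H a) = (\<lambda>p. rweq H a a `` {p}) ` Path H a a"
  by (auto simp: fundamental_group_def quotient_def)

lemma one_fundamental_group: "\<one>\<^bsub>\<pi>\<^sub>1 H a\<^esub> = rweq H a a `` {Refl a}"
  by (simp add: fundamental_group_def)

lemma inv_fundamental_group:
  assumes "p \<in> Path H a a"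
  shows "inv\<^bsub>\<pi>\<^sub>1 H a\<^esub> (rweq H a a `` {p}) = rweq H a a `` {Symm p}"
proof -
  interpret group "\<pi>\<^sub>1 H a"
    by (rule group_fundamental_group)
  have Symm: "Symm p \<in> Path H a a"
    using assms by (simp add: Path_def is_path.Symm)
  have "rweq H a a `` {Trans (Symm p) p} = rweq H a a `` {Refl a}"
    by (rule equiv_class_eq[OF equiv_rweq rweqI[OF rw.tsr[OF assms]]])
  then show ?thesis
    using assms Symm
    by (intro inv_equality)
      (auto simp: mult_fundamental_group one_fundamental_group carrier_fundamental_group)
qed

section \<open>Presentations for types with a single point\<close>

locale one_point_hit =
  fixes H :: "('p, 'e) hit" and b :: 'p and C :: "('p, 'e) cpath set"
  assumes one_point: "x = b"
    and cells_eq: "cells H = (\<lambda>r. (r, Refl b)) ` C"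
    and relators: "C \<subseteq> Path H b b"
begin

abbreviation "X \<equiv> gens H"
abbreviation "F \<equiv> free_group X"
abbreviation "cls p \<equiv> rweq H b b `` {p}"
text \<open>Evaluation in the free group itself reads a loop as a reduced word.\<close>

abbreviation "R \<equiv> path_eval F free_gen ` C"
abbreviation "N \<equiv> normal_closure F R"
abbreviation "\<phi> \<equiv> word_eval (\<pi>\<^sub>1 H b) (\<lambda>e. cls (Gen e))"

lemma Path_simps:
  "Refl b \<in> Path H b b"
  "e \<in> X \<Longrightarrow> Gen e \<in> Path H b b"
  "p \<in> Path H b b \<Longrightarrow> Symm p \<in> Path H b b"
  "p \<in> Path H b b \<Longrightarrow> q \<in> Path H b b \<Longrightarrow> Trans p q \<in> Path H b b"
  using is_path.Gen[of e H] one_point[of "src H e"] one_point[of "tgt H e"]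
  by (auto simp: Path_def intro: is_path.intros)

lemma class_Gen_closed: "(\<lambda>e. cls (Gen e)) \<in> X \<rightarrow> carrier (\<pi>\<^sub>1 H b)"
  by (auto simp: carrier_fundamental_group Path_simps)

sublocale F: group F
  by (rule group_free_group)

sublocale \<phi>: group_hom F "\<pi>\<^sub>1 H b" \<phi>
  by (intro group.group_hom_word_eval group_fundamental_group class_Gen_closed)

lemma free_gen_Pi: "free_gen \<in> X \<rightarrow> carrier F"
  by (simp add: free_gen_closed)

lemma R_closed: "R \<subseteq> carrier F"
  using relators F.path_eval_closed[OF _ free_gen_Pi] by auto

text \<open>The operations of \<open>\<pi>\<^sub>1 H b\<close> are induced by \<open>Refl\<close>,
  \<open>Symm\<close> and \<open>Trans\<close>, so evaluation there is the quotient map. Prescribing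
  \<open>f\<close> only on \<open>X\<close> admits \<open>\<phi> \<circ> free_gen\<close> as an
  instance.\<close>

lemma path_eval_fundamental_group:
  assumes "p \<in> Path H b b" and "\<And>e. e \<in> X \<Longrightarrow> f e = cls (Gen e)"
  shows "path_eval (\<pi>\<^sub>1 H b) f p = cls p"
proof -
  \<comment> \<open>The endpoints vary so that rule induction applies; \<open>one_point\<close>
    identifies each of them with \<open>b\<close>.\<close>
  have "is_path H a c p \<Longrightarrow> path_eval (\<pi>\<^sub>1 H b) f p = cls p" for a c
  proof (induction rule: is_path.induct)
    case (Refl a)
    then show ?case
      using one_point[of a] by (simp add: one_fundamental_group)
  next
    case (Symm a c p)
    then have "p \<in> Path H b b"
      using one_point[of a] one_point[of c] by (simp add: Path_def)
    then show ?case
      using Symm by (simp add: inv_fundamental_group)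
  next
    case (Trans a c p d q)
    then have "p \<in> Path H b b" "q \<in> Path H b b"
      using one_point[of a] one_point[of c] one_point[of d] by (simp_all add: Path_def)
    then show ?case
      using Trans by (simp add: mult_fundamental_group)
  qed (use assms(2) in auto)
  then show ?thesis
    using assms(1) by (auto simp: Path_def)
qed

text \<open>By naturality, \<phi> turns evaluation in \<open>F\<close> into evaluation in
  \<open>\<pi>\<^sub>1 H b\<close>, which is the quotient map.\<close>

lemma hom_path_word:
  assumes "p \<in> Path H b b"
  shows "\<phi> (path_eval F free_gen p) = cls p"
proof -
  have "(\<phi> \<circ> free_gen) e = cls (Gen e)" if "e \<in> X" for e
    using that funcset_mem[OF class_Gen_closed that] by (simp add: free_gen_def)
  then show ?thesis
    using \<phi>.hom_path_eval[OF assms free_gen_Pi] path_eval_fundamental_group[OF assms] by simp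
qed

text \<open>A loop is spelled letter by letter, with \<open>Symm\<close> for inverse letters. This
  lets statements about words be transferred to loops.\<close>

lemma word_path_exists:
  assumes "w \<in> carrier F"
  shows "\<exists>p\<in>Path H b b. path_eval F free_gen p = w"
  using assms
proof (induction w)
  case Nil
  then show ?case
    using Path_simps(1) by (force simp: one_free_group)
next
  case (Cons l w)
  obtain x s where l: "l = (x, s)"
    by (cases l)
  have x: "x \<in> X" and w: "w \<in> carrier F" "reduced (l # w)" "reduced w"
    using Cons.prems by (auto simp: carrier_free_group l reduced_Cons)
  obtain p where p: "p \<in> Path H b b" "path_eval F free_gen p = w"
    using Cons.IH w(1) by blast
  \<comment> \<open>Since \<open>l # w\<close> is reduced, prepending \<open>l\<close> cancels
    nothing.\<close>
  have "[l] \<otimes>\<^bsub>F\<^esub> w = l # w"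
    using w(2,3) by (cases w) (auto simp: mult_free_group reduced_Cons)
  then have "path_eval F free_gen (Trans (if s then Gen x else Symm (Gen x)) p) = l # w"
    using p x by (cases s) (simp_all add: l inv_free_gen, simp add: free_gen_def)
  moreover have "Trans (if s then Gen x else Symm (Gen x)) p \<in> Path H b b"
    using p x by (simp add: Path_simps)
  ultimately show ?case
    by blast
qed

lemma normal_closure_relators: "N \<lhd> F"
  by (rule F.normal_normal_closure[OF R_closed])

text \<open>This supplies the 2-cell condition of \<open>rweq_path_eval\<close> for
  \<open>F Mod N\<close>: the word of a relator lies in \<open>N\<close>, so its coset is
  trivial.\<close>

lemma coset_path_eval_cells:
  assumes "(p, q) \<in> cells H"
  shows "path_eval (F Mod N) (\<lambda>e. N #>\<^bsub>F\<^esub> free_gen e) p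
    = path_eval (F Mod N) (\<lambda>e. N #>\<^bsub>F\<^esub> free_gen e) q"
proof -
  interpret N: normal N F
    by (rule normal_closure_relators)
  interpret h: group_hom F "F Mod N" "\<lambda>w. N #>\<^bsub>F\<^esub> w"
    by (simp add: group_hom_def group_hom_axioms_def group_free_group N.factorgroup_is_group
        N.r_coset_hom_Mod)
  obtain r where r: "r \<in> C" "p = r" "q = Refl b"
    using assms by (auto simp: cells_eq)
  define w where "w = path_eval F free_gen r"
  have w: "w \<in> R" "w \<in> carrier F"
    using r R_closed by (auto simp: w_def)
  \<comment> \<open>Conjugation by the unit exhibits \<open>w\<close> itself among the generators of
    \<open>N\<close>.\<close>
  have "\<one>\<^bsub>F\<^esub> \<otimes>\<^bsub>F\<^esub> w \<otimes>\<^bsub>F\<^esub> inv\<^bsub>F\<^esub> \<one>\<^bsub>F\<^esub>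
      \<in> {g \<otimes>\<^bsub>F\<^esub> r \<otimes>\<^bsub>F\<^esub> inv\<^bsub>F\<^esub> g | g r. g \<in> carrier F \<and> r \<in> R}"
    using w(1) by blast
  then have "w \<in> N"
    using w(2) unfolding normal_closure_def by (simp add: generate.incl)
  then have "N #>\<^bsub>F\<^esub> w = N"
    by (simp add: N.rcos_const)
  moreover have "N #>\<^bsub>F\<^esub> w = path_eval (F Mod N) (\<lambda>e. N #>\<^bsub>F\<^esub> free_gen e) r"
    using h.hom_path_eval[OF subsetD[OF relators r(1)] free_gen_Pi] by (simp add: w_def o_def)
  ultimately show ?thesis
    using r by (simp add: FactGroup_def)
qed

lemma kernel_eq_normal_closure: "kernel F (\<pi>\<^sub>1 H b) \<phi> = N"
proof
  interpret N: normal N F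
    by (rule normal_closure_relators)
  interpret Q: group "F Mod N"
    by (rule N.factorgroup_is_group)
  interpret h: group_hom F "F Mod N" "\<lambda>w. N #>\<^bsub>F\<^esub> w"
    by (simp add: group_hom_def group_hom_axioms_def group_free_group N.factorgroup_is_group
        N.r_coset_hom_Mod)
  let ?f = "\<lambda>e. N #>\<^bsub>F\<^esub> free_gen e"
  show "kernel F (\<pi>\<^sub>1 H b) \<phi> \<subseteq> N"
  proof
    fix w assume "w \<in> kernel F (\<pi>\<^sub>1 H b) \<phi>"
    then have w: "w \<in> carrier F" "\<phi> w = \<one>\<^bsub>\<pi>\<^sub>1 H b\<^esub>"
      by (auto simp: kernel_def)
    obtain p where p: "p \<in> Path H b b" "path_eval F free_gen p = w"
      using word_path_exists[OF w(1)] by blast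
    \<comment> \<open>With \<open>w\<close> spelled by the loop \<open>p\<close>, triviality of
      \<open>\<phi> w\<close> says that \<open>p\<close> is rewrite equal to
      \<open>Refl b\<close>.\<close>
    have "cls p = cls (Refl b)"
      using hom_path_word[OF p(1)] w(2) p(2) by (simp add: one_fundamental_group)
    then have "(p, Refl b) \<in> rweq H b b"
      using p(1) Path_simps(1) by (simp only: class_eq_iff_rweq)
    moreover have "?f \<in> X \<rightarrow> carrier (F Mod N)"
      by (intro funcsetI h.hom_closed free_gen_closed)
    \<comment> \<open>Rewrite invariance carries this equality to \<open>F Mod N\<close>, where
      \<open>p\<close> evaluates to the coset of \<open>w\<close>.\<close>
    ultimately have "path_eval (F Mod N) ?f p = path_eval (F Mod N) ?f (Refl b)"
      using coset_path_eval_cells by (rule Q.rweq_path_eval)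
    then have "N #>\<^bsub>F\<^esub> w = N"
      using h.hom_path_eval[OF p(1) free_gen_Pi] p(2) by (simp add: o_def FactGroup_def)
    then show "w \<in> N"
      using F.rcos_self[OF w(1) N.subgroup_axioms] by simp
  qed
  have kernel: "kernel F (\<pi>\<^sub>1 H b) \<phi> \<lhd> F"
    by (rule \<phi>.normal_kernel)
  have "R \<subseteq> kernel F (\<pi>\<^sub>1 H b) \<phi>"
  proof
    fix w assume w: "w \<in> R"
    then obtain r where r: "r \<in> C" "w = path_eval F free_gen r"
      by blast
    have r': "r \<in> Path H b b"
      using r(1) relators by blast
    have "rw H b b r (Refl b)"
      using r(1) r' Path_simps(1) by (intro rw.cell) (auto simp: cells_eq)
    then have "cls r = cls (Refl b)"
      by (intro equiv_class_eq[OF equiv_rweq] rweqI)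
    then show "w \<in> kernel F (\<pi>\<^sub>1 H b) \<phi>"
      using w R_closed r(2) hom_path_word[OF r'] by (auto simp: kernel_def one_fundamental_group)
  qed
  \<comment> \<open>A normal subgroup containing the relators contains their conjugates, and hence
    the subgroup they generate.\<close>
  then have "{g \<otimes>\<^bsub>F\<^esub> r \<otimes>\<^bsub>F\<^esub> inv\<^bsub>F\<^esub> g | g r. g \<in> carrier F \<and> r \<in> R}
      \<subseteq> kernel F (\<pi>\<^sub>1 H b) \<phi>"
    using normal.inv_op_closed2[OF kernel] by blast
  then show "N \<subseteq> kernel F (\<pi>\<^sub>1 H b) \<phi>"
    unfolding normal_closure_def
    by (intro F.generate_subgroup_incl normal_imp_subgroup kernel)
qed

text \<open>The first isomorphism theorem for \<phi>: surjectivity holds because the class of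
  \<open>p\<close> is the image of the word read off \<open>p\<close>, and the kernel is
  \<open>N\<close>.\<close>

theorem fundamental_group_iso_presented_group: "\<pi>\<^sub>1 H b \<cong> presented_group X R"
proof -
  have "\<phi> ` carrier F = carrier (\<pi>\<^sub>1 H b)"
  proof
    show "carrier (\<pi>\<^sub>1 H b) \<subseteq> \<phi> ` carrier F"
    proof
      fix x assume "x \<in> carrier (\<pi>\<^sub>1 H b)"
      then obtain p where p: "p \<in> Path H b b" "x = cls p"
        by (auto simp: carrier_fundamental_group)
      then have "x = \<phi> (path_eval F free_gen p)"
        by (simp add: hom_path_word)
      moreover have "path_eval F free_gen p \<in> carrier F"
        by (rule F.path_eval_closed[OF p(1) free_gen_Pi])
      ultimately show "x \<in> \<phi> ` carrier F"
        by (rule image_eqI)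
    qed
    show "\<phi> ` carrier F \<subseteq> carrier (\<pi>\<^sub>1 H b)"
      by (rule image_subsetI) (rule \<phi>.hom_closed)
  qed
  then have "F Mod kernel F (\<pi>\<^sub>1 H b) \<phi> \<cong> \<pi>\<^sub>1 H b"
    by (rule \<phi>.FactGroup_iso)
  then have "presented_group X R \<cong> \<pi>\<^sub>1 H b"
    by (simp add: kernel_eq_normal_closure presented_group_def)
  then show ?thesis
    by (rule group.iso_sym[OF group_presented_group[OF R_closed]])
qed

end

section \<open>The surface relator\<close>

lemma path_eval_squares_path: "path_eval (free_group X) free_gen (squares_path n) = squares_word n"
proof -
  \<comment> \<open>Cancellation needs an inverse letter. Hence products of positive words in the
    free group are plain concatenations.\<close>
  have positive: "reduced w" if "\<forall>l\<in>set w. snd l" for w :: "nat letter list"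
    using that
  proof (induction w)
    case (Cons x w)
    then show ?case
      using hd_in_set[of w] by (cases x; cases w) (auto simp: reduced_Cons letter_inv_def)
  qed simp
  \<comment> \<open>The index list is generalised from \<open>[1..<Suc n]\<close> to make induction
    possible.\<close>
  have "path_eval (free_group X) free_gen
      (foldr (\<lambda>i p. Trans (Trans (Gen i) (Gen i)) p) js (Refl base))
    = concat (map (\<lambda>i. [(i, True), (i, True)]) js)" for js :: "nat list"
  proof (induction js)
    case (Cons i js)
    let ?w = "concat (map (\<lambda>i. [(i, True), (i, True)]) js)"
    have "reduced ?w" "reduced ((i, True) # (i, True) # ?w)" "reduced [(i, True)]"
      by (auto intro!: positive)
    then show ?case
      using Cons
      by (cases ?w) (auto simp: free_gen_def mult_free_group letter_inv_def reduced_Cons)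
  qed (simp add: one_free_group)
  then show ?thesis
    by (simp only: squares_path_def squares_word_def)
qed

theorem mainTheorem10:
  fixes n :: nat
  assumes "n \<ge> 1"
  shows "\<pi>\<^sub>1 (nonorientable_surface n) base \<cong> presented_group {1..n} {squares_word n}"
proof -
  \<comment> \<open>The only 2-cell contracts \<open>squares_path n\<close>, so there is one
    relator.\<close>
  interpret one_point_hit "nonorientable_surface n" base "{squares_path n}"
  proof
    show "x = base" for x
      by (cases x)
    show "cells (nonorientable_surface n) = (\<lambda>r. (r, Refl base)) ` {squares_path n}"
      by (simp add: nonorientable_surface_def)
  qed (simp add: squares_path_in_Path)
  show ?thesis
    \<comment> \<open>First the relator set becomes \<open>{squares_word n}\<close>; then unfolding
      the surface turns its generators into \<open>{1..n}\<close>.\<close>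
    using fundamental_group_iso_presented_group
    by (simp add: path_eval_squares_path) (simp add: nonorientable_surface_def)
qed

end
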